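(* Let $\mathbf{A}=[a_{i,j}]\in\mathbb{R}^{n_x\times n_x}$ and let $\mathbf{C}\in\mathbb{R}^{n_y\times n_x}$ have columns $\mathbf{C}_1,\dots,\mathbf{C}_{n_x}$. Consider the linear program in the variables $\mathbf{L}\in\mathbb{R}^{n_x\times n_y}$ (with rows $\boldsymbol{\ell}_i^{\mathrm T}$), $\mathbf{B}=[b_{i,j}]\in\mathbb{R}^{n_x\times n_x}$ and $s\in\mathbb{R}$: $$\begin{aligned}\min_{\mathbf{L},\mathbf{B},s}\ & s\\ \text{s.t. } & \boldsymbol{\ell}_i^{\mathrm T}\mathbf{C}_j-b_{i,j}\le a_{i,j},\quad \forall i,\ \forall j\ne i,\\ & -\boldsymbol{\ell}_i^{\mathrm T}\mathbf{C}_j-b_{i,j}\le -a_{i,j},\quad \forall i,\ \forall j\ne i,\\ & -\boldsymbol{\ell}_i^{\mathrm T}\mathbf{C}_i+\sum_{j\ne i}b_{i,j}-s\le -a_{i,i},\quad \forall i,\end{aligned}$$ where $i,j$ range over $\{1,\dots,n_x\}$. Then any $\mathbf{L}$ which is (the $\mathbf{L}$-part of) a solution of this linear program with optimal objective value $s^*<0$ satisfies $$a_{i,i}-\boldsymbol{\ell}_i^{\mathrm T}\mathbf{C}_i+\sum_{j\ne i}\left|a_{i,j}-\boldsymbol{\ell}_i^{\mathrm T}\mathbf{C}_j\right|<0\quad\text{for all } i\in\{1,\dots,n_x\}.$$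
   Context: $n_x$ and $n_y$ are positive integers. A solution of the linear program means an optimal (minimizing feasible) point $(\mathbf{L},\mathbf{B},s)$. *)

theory Defs
  imports "HOL-Analysis.Analysis"
begin

text \<open>The vector \<open>\<ell>\<^sub>i\<close> (the transpose of the \<open>i\<close>-th row of \<open>L\<close>) is \<open>row i L\<close>, and \<open>C\<^sub>j\<close> is
  \<open>column j C\<close>. The diagonal entries of \<open>B\<close> are variables of the program that occur in no
  constraint.\<close>

definition lp_feasible ::
  "real^'nx^'nx \<Rightarrow> real^'nx^'ny \<Rightarrow> (real^'ny^'nx) \<times> (real^'nx^'nx) \<times> real \<Rightarrow> bool"
  where
  "lp_feasible A C = (\<lambda>(L, B, s).
     (\<forall>i j. j \<noteq> i \<longrightarrow> row i L \<bullet> column j C - B $ i $ j \<le> A $ i $ j) \<and>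
     (\<forall>i j. j \<noteq> i \<longrightarrow> - (row i L \<bullet> column j C) - B $ i $ j \<le> - (A $ i $ j)) \<and>
     (\<forall>i. - (row i L \<bullet> column i C) + (\<Sum>j | j \<noteq> i. B $ i $ j) - s \<le> - (A $ i $ i)))"

definition lp_objective :: "(real^'ny^'nx) \<times> (real^'nx^'nx) \<times> real \<Rightarrow> real"
  where "lp_objective = (\<lambda>(L, B, s). s)"

definition lp_solution ::
  "real^'nx^'nx \<Rightarrow> real^'nx^'ny \<Rightarrow> (real^'ny^'nx) \<times> (real^'nx^'nx) \<times> real \<Rightarrow> bool"
  where "lp_solution A C = is_arg_min lp_objective (lp_feasible A C)"

end

theory Submission
  imports Defs
begin

text \<open>The first two families of constraints say exactly that \<open>B\<close> dominates the absolute values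
  of the off-diagonal entries of \<open>A - L C\<close>. Replacing these absolute values by the entries of \<open>B\<close>
  can therefore only increase the Gershgorin-type quantity of row \<open>i\<close>, and the third family bounds
  the increased quantity by \<open>s\<close>. So \<open>s\<close> is an upper bound for every row, at any feasible point;
  at a solution with negative objective value this bound is negative.\<close>

text \<open>The variables \<open>B\<close> and \<open>s\<close> linearise the absolute values and the maximum over the rows.\<close>

lemma lp_feasible_row_bound:
  fixes A :: "real^'nx^'nx" and C :: "real^'nx^'ny"
  assumes "lp_feasible A C (L, B, s)"
  shows "A $ i $ i - row i L \<bullet> column i C
           + (\<Sum>j | j \<noteq> i. \<bar>A $ i $ j - row i L \<bullet> column j C\<bar>) \<le> s"
proof -
  have upper: "row i L \<bullet> column j C - B $ i $ j \<le> A $ i $ j"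
    and lower: "- (row i L \<bullet> column j C) - B $ i $ j \<le> - (A $ i $ j)" if "j \<noteq> i" for j
    using assms that by (auto simp: lp_feasible_def)
  have diag: "- (row i L \<bullet> column i C) + (\<Sum>j | j \<noteq> i. B $ i $ j) - s \<le> - (A $ i $ i)"
    using assms by (auto simp: lp_feasible_def)
  have "\<bar>A $ i $ j - row i L \<bullet> column j C\<bar> \<le> B $ i $ j" if "j \<noteq> i" for j
    using upper[OF that] lower[OF that] by linarith
  then have "(\<Sum>j | j \<noteq> i. \<bar>A $ i $ j - row i L \<bullet> column j C\<bar>) \<le> (\<Sum>j | j \<noteq> i. B $ i $ j)"
    by (intro sum_mono) simp
  with diag show ?thesis by linarith
qed

theorem corollary3:
  fixes A :: "real^'nx^'nx" and C :: "real^'nx^'ny"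
    and L :: "real^'ny^'nx" and B :: "real^'nx^'nx" and s :: real
  assumes "lp_solution A C (L, B, s)"
    and "lp_objective (L, B, s) < 0"
  shows "\<forall>i. A $ i $ i - row i L \<bullet> column i C
             + (\<Sum>j | j \<noteq> i. \<bar>A $ i $ j - row i L \<bullet> column j C\<bar>) < 0"
proof -
  have "lp_feasible A C (L, B, s)"
    using assms(1) by (simp add: lp_solution_def is_arg_min_def)
  moreover have "s < 0"
    using assms(2) by (simp add: lp_objective_def)
  ultimately show ?thesis
    using lp_feasible_row_bound by (blast intro: le_less_trans)
qed

end
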